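(* Let $V$ be a valuation ring, let $f(x),g(x),p(x),q(x)\in V[x]$, and suppose that $$M=\begin{pmatrix} f(x) & g(x) & 0\\ p(x) & q(x) & 0\\ 0&0&1\end{pmatrix}\in \mathrm{SL}_3(V[x]).$$ Then $M\in E_3(V[x])$.
   Context: All rings are commutative with unity. A valuation ring is a commutative ring $V$ whose principal ideals are totally ordered by inclusion, i.e. for any $a,b\in V$ either $a\mid b$ or $b\mid a$ (zero divisors are allowed; $V$ need not be a domain). For a commutative ring $R$, $\mathrm{SL}_n(R)$ is the group of $n\times n$ matrices over $R$ of determinant $1$, and $E_n(R)$ is the subgroup generated by the elementary matrices $I_n+a\,\mathbf{e}_{ij}$ with $a\in R$, $i\neq j$, where $\mathbf{e}_{ij}$ is the matrix whose only nonzero entry is $1$ at position $(i,j)$. *)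

theory Defs
  imports "HOL-Analysis.Determinants" "HOL-Computational_Algebra.Polynomial"
    "HOL-Algebra.Generated_Groups"
begin

definition valuation_ring :: "'a::comm_ring_1 itself \<Rightarrow> bool" where
  "valuation_ring _ \<longleftrightarrow> (\<forall>a b :: 'a. a dvd b \<or> b dvd a)"

definition SL :: "('a::comm_ring_1 ^ 'n ^ 'n) monoid" where
  "SL = \<lparr>carrier = {A. det A = 1}, mult = (**), one = mat 1\<rparr>"

definition elementary_matrix :: "'n \<Rightarrow> 'n \<Rightarrow> 'a \<Rightarrow> 'a::comm_ring_1 ^ 'n ^ 'n" where
  "elementary_matrix i j a = mat 1 + (\<chi> k l. if k = i \<and> l = j then a else 0)"

definition elementary_subgroup :: "('a::comm_ring_1 ^ 'n ^ 'n) set" where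
  "elementary_subgroup = generate SL {elementary_matrix i j a | i j a. i \<noteq> j}"

lemma det_elementary_matrix:
  assumes "i \<noteq> j"
  shows "det (elementary_matrix i j a) = 1"
proof -
  have "elementary_matrix i j a =
      (\<chi> k. if k = i then row i (mat 1) + a *s row j (mat 1) else row k (mat 1))"
    by (auto simp: elementary_matrix_def vec_eq_iff row_def mat_def)
  then show ?thesis
    using det_row_operation[OF assms, of "mat 1" a] by (simp add: det_I)
qed

lemma right_inverse_if_det_1:
  fixes A :: "'a::comm_ring_1 ^ 'n ^ 'n"
  assumes "det A = 1"
  shows "\<exists>B. A ** B = mat 1"
proof
  \<comment> \<open>the adjugate of \<open>A\<close>\<close>
  let ?B = "\<chi> i j. det (\<chi> k. if k = j then axis i 1 else row k A)"
  have "(\<Sum>i\<in>UNIV. A $ l $ i * ?B $ i $ j) = mat 1 $ l $ j" for l j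
  proof -
    have "(\<Sum>i\<in>UNIV. A $ l $ i * ?B $ i $ j) =
        (\<Sum>i\<in>UNIV. det (\<chi> k. if k = j then A $ l $ i *s axis i 1 else row k A))"
      by (simp add: det_row_mul)
    also have "\<dots> = det (\<chi> k. if k = j then \<Sum>i\<in>UNIV. A $ l $ i *s axis i 1 else row k A)"
      by (rule det_linear_row_sum[symmetric]) simp
    also have "(\<Sum>i\<in>UNIV. A $ l $ i *s axis i 1) = row l A"
      by (simp add: vec_eq_iff row_def axis_def if_distrib sum.delta cong: if_cong)
    also have "det (\<chi> k. if k = j then row l A else row k A) = mat 1 $ l $ j"
    proof (cases "l = j")
      case True
      then have "(\<chi> k. if k = j then row l A else row k A) = A"
        by (auto simp: vec_eq_iff row_def)
      then show ?thesis
        using assms True by (simp add: mat_def)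
    next
      case False
      then have "det (\<chi> k. if k = j then row l A else row k A) = 0"
        by (intro det_identical_rows[of l j]) (auto simp: vec_eq_iff row_def)
      then show ?thesis
        using False by (simp add: mat_def)
    qed
    finally show ?thesis .
  qed
  then show "A ** ?B = mat 1"
    by (simp add: vec_eq_iff matrix_matrix_mult_def)
qed

lemma group_SL: "group (SL :: ('a::comm_ring_1 ^ 'n ^ 'n) monoid)"
proof (rule groupI)
  fix A :: "'a ^ 'n ^ 'n"
  assume "A \<in> carrier SL"
  then have A: "det A = 1"
    by (simp add: SL_def)
  then obtain B where B: "A ** B = mat 1"
    using right_inverse_if_det_1 by blast
  then have dB: "det B = 1"
    using A by (metis det_I det_mul mult_1)
  then obtain C where "B ** C = mat 1"
    using right_inverse_if_det_1 by blast
  then have "B ** A = mat 1"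
    using B by (metis matrix_mul_assoc matrix_mul_rid)
  then show "\<exists>y\<in>carrier SL. y \<otimes>\<^bsub>SL\<^esub> A = \<one>\<^bsub>SL\<^esub>"
    using dB by (auto simp: SL_def)
qed (auto simp: SL_def det_mul det_I matrix_mul_assoc)

lemma subgroup_elementary_subgroup:
  "subgroup elementary_subgroup (SL :: ('a::comm_ring_1 ^ 'n ^ 'n) monoid)"
  unfolding elementary_subgroup_def
  by (rule group.generate_is_subgroup[OF group_SL]) (auto simp: SL_def det_elementary_matrix)

end

theory Submission
  imports Defs
begin

text \<open>
  Fix a pair \<open>(a, b)\<close> in a commutative ring. Any two matrices of determinant 1 with first row
  \<open>(a, b)\<close> differ by one elementary row operation, so whether such a matrix becomes elementary
  after adding a diagonal 1 depends on \<open>(a, b)\<close> alone (\<open>mennicke_trivial_any_completion\<close>). Call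
  the pair trivial in this case. The third dimension buys the one property that fails for
  two-by-two matrices: if \<open>(a, b)\<close> and \<open>(a', b)\<close> are trivial, then so is \<open>(a a', b)\<close>
  (\<open>mennicke_trivial_mult\<close>, the multiplicativity of Mennicke symbols). Adding multiples of
  one entry to the other and exchanging the entries also preserve triviality, and a pair with a
  unit entry is trivial. The theorem therefore says that every comaximal pair \<open>(f, g)\<close> of
  polynomials over a valuation ring is trivial.

  Multiplicativity allows two kinds of factors to be dropped. If \<open>g(0)\<close> is a unit, then
  \<open>(x, g)\<close> reduces to \<open>(x, g(0))\<close>; so after clearing the constant term of \<open>f\<close> with a multiple of
  \<open>g\<close> one may divide \<open>f\<close> by \<open>x\<close> (\<open>cancel_constant_term\<close>). And \<open>(c, g)\<close> is trivial for every
  constant \<open>c\<close> comaximal with \<open>g\<close> (\<open>mennicke_trivial_const\<close>), so one may pass from \<open>f\<close> to a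
  primitive polynomial, that is, one with a unit among its coefficients. The reason for the latter
  is that the leading coefficient \<open>b\<close> of \<open>g\<close> is nilpotent modulo \<open>c\<close>; in a valuation ring, \<open>c\<close>
  is then 0 or a power of \<open>b\<close> times a divisor of \<open>b\<close>, and modulo such factors the leading
  term of \<open>g\<close> vanishes.

  The proof is by induction on a common bound \<open>n + 1\<close> for the degrees of \<open>f\<close> and \<open>g\<close>. Since the
  base ring is local, one of the constant terms is a unit, say \<open>g(0)\<close>. Clearing the constant term,
  dividing by \<open>x\<close> and by the content makes \<open>f\<close> primitive of degree at most \<open>n\<close>. If \<open>f(0)\<close> is
  now a unit, it can be used in turn to bring the degree of \<open>g\<close> down to \<open>n\<close>. If it is not, then
  clearing it changes \<open>f\<close> only by a multiple of the maximal ideal, so that the division by \<open>x\<close>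
  keeps \<open>f\<close> primitive and moves its first unit coefficient one place closer to the constant
  term; after finitely many steps \<open>f(0)\<close> is a unit (\<open>mennicke_trivial_primitive\<close>).
\<close>

section \<open>Elementary three-by-three matrices\<close>

definition mat3 :: "'a \<Rightarrow> 'a \<Rightarrow> 'a \<Rightarrow> 'a \<Rightarrow> 'a \<Rightarrow> 'a \<Rightarrow> 'a \<Rightarrow> 'a \<Rightarrow> 'a \<Rightarrow> 'a::comm_ring_1 ^ 3 ^ 3" where
  "mat3 a b c d e f g h i = vector [vector [a, b, c], vector [d, e, f], vector [g, h, i]]"

lemma mat3_mult:
  "mat3 a b c d e f g h i ** mat3 a' b' c' d' e' f' g' h' i' =
   mat3 (a * a' + b * d' + c * g') (a * b' + b * e' + c * h') (a * c' + b * f' + c * i')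
        (d * a' + e * d' + f * g') (d * b' + e * e' + f * h') (d * c' + e * f' + f * i')
        (g * a' + h * d' + i * g') (g * b' + h * e' + i * h') (g * c' + h * f' + i * i')"
  by (simp add: mat3_def vec_eq_iff forall_3 sum_3 matrix_matrix_mult_def)

lemma det_mat3:
  "det (mat3 a b c d e f g h i) = a * (e * i - f * h) - b * (d * i - f * g) + c * (d * h - e * g)"
  by (simp add: det_3 mat3_def algebra_simps)

lemma elementary_matrix_3:
  "elementary_matrix 1 2 a = mat3 1 a 0 0 1 0 0 0 1"
  "elementary_matrix 2 1 a = mat3 1 0 0 a 1 0 0 0 1"
  "elementary_matrix 2 3 a = mat3 1 0 0 0 1 a 0 0 1"
  "elementary_matrix 3 2 a = mat3 1 0 0 0 1 0 0 a 1"
  "elementary_matrix 3 1 a = mat3 1 0 0 0 1 0 a 0 1"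
  by (simp_all add: mat3_def vec_eq_iff forall_3 elementary_matrix_def mat_def)

lemma elementary_matrix_in:
  "i \<noteq> j \<Longrightarrow> elementary_matrix i j a \<in> elementary_subgroup"
  unfolding elementary_subgroup_def by (rule generate.incl) blast

lemma elementary_mult:
  "A \<in> elementary_subgroup \<Longrightarrow> B \<in> elementary_subgroup \<Longrightarrow> A ** B \<in> elementary_subgroup"
  using subgroup.m_closed[OF subgroup_elementary_subgroup, of A B] by (simp add: SL_def)

lemma det_elementary: "A \<in> elementary_subgroup \<Longrightarrow> det A = 1"
  using subgroup.mem_carrier[OF subgroup_elementary_subgroup, of A] by (simp add: SL_def)

lemma elementary_mat3:
  "mat3 1 a 0 0 1 0 0 0 1 \<in> elementary_subgroup"
  "mat3 1 0 0 a 1 0 0 0 1 \<in> elementary_subgroup"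
  "mat3 1 0 0 0 1 a 0 0 1 \<in> elementary_subgroup"
  "mat3 1 0 0 0 1 0 0 a 1 \<in> elementary_subgroup"
  "mat3 1 0 0 0 1 0 a 0 1 \<in> elementary_subgroup"
  by (simp_all flip: elementary_matrix_3 add: elementary_matrix_in)

text \<open>
  In the coordinates involved, each of these is a quarter turn, and a quarter turn is a product of
  three shears.
\<close>

lemma signed_swaps_elementary:
  "mat3 0 (-1) 0 1 0 0 0 0 1 \<in> elementary_subgroup"
  "mat3 1 0 0 0 0 1 0 (-1) 0 \<in> elementary_subgroup"
  "mat3 1 0 0 0 0 (-1) 0 1 0 \<in> elementary_subgroup"
proof -
  have "mat3 1 0 0 1 1 0 0 0 1 ** mat3 1 (-1) 0 0 1 0 0 0 1 ** mat3 1 0 0 1 1 0 0 0 1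
          \<in> elementary_subgroup"
    by (intro elementary_mult elementary_mat3)
  then show "mat3 0 (-1) 0 1 0 0 0 0 1 \<in> elementary_subgroup"
    by (simp add: mat3_mult)
  have "mat3 1 0 0 0 1 1 0 0 1 ** mat3 1 0 0 0 1 0 0 (-1) 1 ** mat3 1 0 0 0 1 1 0 0 1
          \<in> elementary_subgroup"
    by (intro elementary_mult elementary_mat3)
  then show "mat3 1 0 0 0 0 1 0 (-1) 0 \<in> elementary_subgroup"
    by (simp add: mat3_mult)
  have "mat3 1 0 0 0 1 0 0 1 1 ** mat3 1 0 0 0 1 (-1) 0 0 1 ** mat3 1 0 0 0 1 0 0 1 1
          \<in> elementary_subgroup"
    by (intro elementary_mult elementary_mat3)
  then show "mat3 1 0 0 0 0 (-1) 0 1 0 \<in> elementary_subgroup"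
    by (simp add: mat3_mult)
qed

section \<open>Trivial Mennicke symbols\<close>

text \<open>
  The Mennicke symbol of \<open>(a, b)\<close> is the class of such a matrix modulo elementary ones. Only its
  vanishing matters here, so no quotient is formed. Membership in the elementary subgroup already
  forces \<open>a * d - b * c = 1\<close>.
\<close>

definition mennicke_trivial :: "'a::comm_ring_1 \<Rightarrow> 'a \<Rightarrow> bool" where
  "mennicke_trivial a b \<longleftrightarrow> (\<exists>c d. mat3 a b 0 c d 0 0 0 1 \<in> elementary_subgroup)"

text \<open>
  Two completions \<open>A\<close> and \<open>A'\<close> of the same first row differ by the factor \<open>A * inverse A'\<close>, which
  fixes the first unit row vector and has determinant 1, hence is lower unitriangular.
\<close>

lemma mennicke_trivial_any_completion:
  assumes "mennicke_trivial a b" and "a * d - b * c = 1"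
  shows "mat3 a b 0 c d 0 0 0 1 \<in> elementary_subgroup"
proof -
  obtain c' d' where E: "mat3 a b 0 c' d' 0 0 0 1 \<in> elementary_subgroup"
    using assms(1) by (auto simp: mennicke_trivial_def)
  then have det: "a * d' - b * c' = 1"
    using det_elementary by (fastforce simp: det_mat3)
  have "mat3 1 0 0 (c * d' - d * c') 1 0 0 0 1 ** mat3 a b 0 c' d' 0 0 0 1 \<in> elementary_subgroup"
    by (intro elementary_mult elementary_mat3 E)
  moreover have "(c * d' - d * c') * a + c' = c"
  proof -
    have "(c * d' - d * c') * a + c' = c * (a * d' - b * c') - c' * (a * d - b * c) + c'"
      by (simp add: algebra_simps)
    then show ?thesis
      using assms(2) det by simp
  qed
  moreover have "(c * d' - d * c') * b + d' = d"
  proof -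
    have "(c * d' - d * c') * b + d' = d * (a * d' - b * c') - d' * (a * d - b * c) + d'"
      by (simp add: algebra_simps)
    then show ?thesis
      using assms(2) det by simp
  qed
  ultimately show ?thesis
    by (simp add: mat3_mult)
qed

lemma mennicke_trivial_one_zero: "mennicke_trivial 1 0"
  using elementary_mat3(1)[of 0] by (auto simp: mennicke_trivial_def)

lemma mennicke_trivial_add_left:
  assumes "mennicke_trivial a b"
  shows "mennicke_trivial (a + t * b) b"
proof -
  obtain c d where "mat3 a b 0 c d 0 0 0 1 \<in> elementary_subgroup"
    using assms by (auto simp: mennicke_trivial_def)
  then have "mat3 a b 0 c d 0 0 0 1 ** mat3 1 0 0 t 1 0 0 0 1 \<in> elementary_subgroup"
    by (intro elementary_mult elementary_mat3)
  then show ?thesis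
    by (auto simp: mat3_mult mennicke_trivial_def mult.commute)
qed

lemma mennicke_trivial_rotate:
  assumes "mennicke_trivial a b"
  shows "mennicke_trivial b (- a)"
proof -
  obtain c d where "mat3 a b 0 c d 0 0 0 1 \<in> elementary_subgroup"
    using assms by (auto simp: mennicke_trivial_def)
  then have "mat3 a b 0 c d 0 0 0 1 ** mat3 0 (-1) 0 1 0 0 0 0 1 \<in> elementary_subgroup"
    by (intro elementary_mult signed_swaps_elementary)
  then show ?thesis
    by (auto simp: mat3_mult mennicke_trivial_def)
qed

text \<open>
  Put the first matrix in the coordinates 1 and 2 and the second one in the coordinates 1 and 3.
  The first row of the product is \<open>(a a', b, a b)\<close>, and a column operation clears its last
  entry. The matrix now contains the entry \<open>-1\<close>, which serves as a pivot: clearing its row and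
  column leaves, up to a signed exchange of rows, a block matrix with first row \<open>(a a', b)\<close>.
\<close>

lemma mennicke_trivial_mult:
  assumes "mennicke_trivial a b" and "mennicke_trivial a' b"
  shows "mennicke_trivial (a * a') b"
proof -
  obtain c d where A: "mat3 a b 0 c d 0 0 0 1 \<in> elementary_subgroup" (is "?A \<in> _")
    using assms(1) by (auto simp: mennicke_trivial_def)
  obtain c' d' where B: "mat3 a' b 0 c' d' 0 0 0 1 \<in> elementary_subgroup" (is "?B \<in> _")
    using assms(2) by (auto simp: mennicke_trivial_def)
  let ?R = "mat3 1 0 0 0 0 1 0 (-1) 0 :: 'a ^ 3 ^ 3"
  let ?L = "mat3 1 0 0 0 0 (-1) 0 1 0 :: 'a ^ 3 ^ 3"
  have det: "a * d = 1 + b * c"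
    using det_elementary[OF A] by (simp add: det_mat3 algebra_simps)
  \<comment> \<open>Conjugation by \<open>?R\<close>, whose inverse is \<open>?L\<close>, moves the second block to the coordinates 1 and 3.\<close>
  have "?A ** (?L ** ?B ** ?R) ** mat3 1 0 0 0 1 (- a) 0 0 1
      = mat3 (a * a') b 0 (c * a') d (-1) c' 0 d'"
    by (simp add: mat3_mult det algebra_simps)
  then have "mat3 (a * a') b 0 (c * a') d (-1) c' 0 d' \<in> elementary_subgroup" (is "?N \<in> _")
    by (metis A B elementary_mult elementary_mat3(3) signed_swaps_elementary(2,3))
  \<comment> \<open>The entry \<open>-1\<close> clears the rest of its row and column.\<close>
  then have "?R ** (mat3 1 0 0 0 1 0 0 d' 1 ** ?N ** mat3 1 0 0 0 1 0 (c * a') 0 1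
      ** mat3 1 0 0 0 1 0 0 d 1) \<in> elementary_subgroup"
    by (intro elementary_mult elementary_mat3 signed_swaps_elementary)
  then show ?thesis
    unfolding mennicke_trivial_def
    by (intro exI[of _ "d' * (c * a') + c'"] exI[of _ "d' * d"]) (simp add: mat3_mult)
qed

lemma mennicke_trivial_one: "mennicke_trivial 1 b"
proof -
  have "mennicke_trivial 0 (- 1::'a)"
    by (rule mennicke_trivial_rotate[OF mennicke_trivial_one_zero])
  then have "mennicke_trivial (- 1 :: 'a) 0"
    using mennicke_trivial_rotate by fastforce
  then have "mennicke_trivial 0 (1 :: 'a)"
    using mennicke_trivial_rotate by fastforce
  then have "mennicke_trivial (- b) 1"
    using mennicke_trivial_add_left[of 0 1 "- b"] by simp
  then show ?thesis
    using mennicke_trivial_rotate by fastforce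
qed

text \<open>
  A unit entry can turn the other entry into any prescribed element, hence into \<open>1\<close> or \<open>-1\<close>. The
  signs below come from the quarter turns that exchange the two entries.
\<close>

lemma mennicke_trivial_unit_left:
  assumes "u dvd 1"
  shows "mennicke_trivial u b"
proof -
  obtain v where v: "1 = u * v"
    using assms by (auto elim: dvdE)
  have "mennicke_trivial (- u) (1 :: 'a)"
    using mennicke_trivial_add_left[OF mennicke_trivial_rotate[OF mennicke_trivial_rotate[OF
      mennicke_trivial_one[of "- 1"]]], of "1 - u"]
    by simp
  then have "mennicke_trivial 1 u"
    using mennicke_trivial_rotate by fastforce
  then have "mennicke_trivial (1 + ((- b - 1) * v) * u) u"
    by (rule mennicke_trivial_add_left)
  moreover have "1 + ((- b - 1) * v) * u = - b"
    using v by (simp add: mult.assoc mult.commute[of v u])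
  ultimately have "mennicke_trivial (- b) u"
    by simp
  then show ?thesis
    using mennicke_trivial_rotate by fastforce
qed

text \<open>
  A quarter turn exchanges the entries up to a sign, and multiplicativity absorbs the sign, since
  \<open>-1\<close> is a unit.
\<close>

lemma mennicke_trivial_commute:
  assumes "mennicke_trivial a b"
  shows "mennicke_trivial b a"
  using mennicke_trivial_rotate[OF mennicke_trivial_mult[OF mennicke_trivial_unit_left[of "-1"] assms]]
  by simp

lemma mennicke_trivial_add_right:
  "mennicke_trivial a b \<Longrightarrow> mennicke_trivial a (b + t * a)"
  by (blast intro: mennicke_trivial_commute mennicke_trivial_add_left)

lemma mennicke_trivial_unit_right: "u dvd 1 \<Longrightarrow> mennicke_trivial a u"
  by (blast intro: mennicke_trivial_commute mennicke_trivial_unit_left)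

lemma mennicke_trivial_power:
  "mennicke_trivial a b \<Longrightarrow> mennicke_trivial (a ^ k) b"
  by (induction k) (auto intro: mennicke_trivial_one mennicke_trivial_mult)

section \<open>Comaximal pairs and valuation rings\<close>

text \<open>
  The constant \<open>coprime\<close> asks only that common divisors be units. In a polynomial ring over a
  general valuation ring this is weaker than generating the unit ideal, which is what completing
  a row to a matrix of determinant 1 requires.
\<close>

definition comaximal :: "'a::comm_ring_1 \<Rightarrow> 'a \<Rightarrow> bool" where
  "comaximal a b \<longleftrightarrow> (\<exists>s t. s * a + t * b = 1)"

lemma comaximal_commute: "comaximal a b \<Longrightarrow> comaximal b a"
  unfolding comaximal_def by (metis add.commute)

lemma comaximal_dvd_left: "comaximal a b \<Longrightarrow> a' dvd a \<Longrightarrow> comaximal a' b"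
  unfolding comaximal_def by (metis dvdE mult.assoc mult.commute)

lemma comaximal_diff_left: "comaximal a b \<Longrightarrow> comaximal (a - r * b) b"
proof -
  assume "comaximal a b"
  then obtain s t where "s * a + t * b = 1"
    by (auto simp: comaximal_def)
  then have "s * (a - r * b) + (t + s * r) * b = 1"
    by (simp add: algebra_simps)
  then show ?thesis
    by (auto simp: comaximal_def)
qed

text \<open>A valuation ring is local, as whichever of \<open>a\<close> and \<open>b\<close> divides the other divides the sum.\<close>

lemma valuation_ring_unit_add:
  fixes a b :: "'v::comm_ring_1"
  assumes "valuation_ring TYPE('v)" and "a + b dvd 1"
  shows "a dvd 1 \<or> b dvd 1"
proof -
  have "a dvd b \<or> b dvd a"
    using assms(1) by (auto simp: valuation_ring_def)
  then have "a dvd a + b \<or> b dvd a + b"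
    by auto
  then show ?thesis
    using assms(2) dvd_trans by blast
qed

lemma valuation_ring_comaximal_unit:
  fixes a b :: "'v::comm_ring_1"
  assumes "valuation_ring TYPE('v)" and "comaximal a b"
  shows "a dvd 1 \<or> b dvd 1"
  using assms valuation_ring_unit_add
  by (metis comaximal_def dvd_mult_right dvd_refl)

lemma comaximal_coeff_0:
  assumes "comaximal f g"
  shows "comaximal (coeff f 0) (coeff g 0)"
proof -
  obtain s t where "s * f + t * g = 1"
    using assms by (auto simp: comaximal_def)
  then have "coeff (s * f + t * g) 0 = coeff 1 0"
    by simp
  then show ?thesis
    by (auto simp: comaximal_def coeff_mult)
qed

text \<open>
  For \<open>f = 0\<close> the content \<open>c\<close> is 0, and the primitive part may be any primitive polynomial of
  degree 0.
\<close>

lemma valuation_ring_primitive_part: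
  fixes f :: "'v::comm_ring_1 poly"
  assumes V: "valuation_ring TYPE('v)"
  shows "\<exists>c f'. f = smult c f' \<and> degree f' \<le> degree f \<and> (\<exists>k. coeff f' k dvd 1)"
proof (induction f)
  case 0
  show ?case
    by (intro exI[of _ 0] exI[of _ 1]) (auto intro: exI[of _ 0])
next
  case (pCons a f)
  then obtain c f' k where f': "f = smult c f'" "degree f' \<le> degree f" "coeff f' k dvd 1"
    by blast
  show ?case
  proof (cases "f = 0")
    case True
    then show ?thesis
      by (intro exI[of _ a] exI[of _ 1]) (auto intro: exI[of _ 0])
  next
    case False
    consider r where "a = c * r" | r where "c = a * r"
      using V unfolding valuation_ring_def by (meson dvdE)
    then show ?thesis
    proof cases
      case (1 r)
      have "pCons a f = smult c (pCons r f')"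
        using 1 f'(1) by simp
      moreover have "degree (pCons r f') \<le> degree (pCons a f)"
        using f'(2) False by (simp add: degree_pCons_eq_if)
      moreover have "coeff (pCons r f') (Suc k) dvd 1"
        using f'(3) by simp
      ultimately show ?thesis
        by blast
    next
      case (2 r)
      have "pCons a f = smult a (pCons 1 (smult r f'))"
        using 2 f'(1) by simp
      moreover have "degree (pCons 1 (smult r f')) \<le> degree (pCons a f)"
        using f'(2) False degree_smult_le[of r f'] by (simp add: degree_pCons_eq_if)
      moreover have "coeff (pCons 1 (smult r f')) 0 dvd 1"
        by simp
      ultimately show ?thesis
        by blast
    qed
  qed
qed

section \<open>Constants paired with a polynomial\<close>

lemma dvd_last_summand:
  fixes c :: "'a::comm_ring_1"
  assumes "c * y + (S + b * z) = 0" and "c dvd x * S"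
  shows "c dvd b * x * z"
proof -
  have "b * x * z = x * (c * y + (S + b * z)) - (c * (x * y) + x * S)"
    by (simp add: algebra_simps)
  then have "b * x * z = - (c * (x * y) + x * S)"
    using assms(1) by simp
  moreover have "c dvd - (c * (x * y) + x * S)"
    unfolding dvd_minus_iff by (intro dvd_add dvd_triv_left assms(2))
  ultimately show ?thesis
    by simp
qed

text \<open>
  Modulo \<open>c\<close> the polynomial \<open>g\<close> has an inverse \<open>t\<close>. All coefficients of \<open>g * t\<close> of positive index
  vanish modulo \<open>c\<close>; read from the top downwards, they show that the leading coefficient kills the
  top coefficient of \<open>t\<close>, its square kills the next one, and so on. Some power thus kills the
  constant term of \<open>t\<close>, which is a unit modulo \<open>c\<close>.
\<close>

lemma lead_coeff_nilpotent_mod: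
  fixes c :: "'v::comm_ring_1"
  assumes cg: "comaximal [:c:] g" and deg: "degree g > 0"
  shows "\<exists>N. c dvd lead_coeff g ^ N"
proof -
  let ?n = "degree g" and ?b = "lead_coeff g"
  obtain s t where "s * [:c:] + t * g = 1"
    using cg by (auto simp: comaximal_def)
  then have st: "smult c s + g * t = 1"
    by (simp add: mult.commute)
  define d where "d = degree t"
  have *: "c dvd ?b ^ Suc d * coeff t k" for k
  proof -
    \<comment> \<open>Truncated subtraction makes the exponent 0 for \<open>k > d\<close>, where the coefficient is 0.\<close>
    have "c dvd ?b ^ (Suc d - k) * coeff t k" for k
    proof (induction "Suc d - k" arbitrary: k rule: less_induct)
      case less
      show ?case
      proof (cases "k \<le> d")
        case False
        then show ?thesis
          by (simp add: coeff_eq_0 d_def)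
      next
        case True
        have coeffs: "c * coeff s (?n + k) + coeff (g * t) (?n + k) = 0"
          using arg_cong[OF st, of "\<lambda>h. coeff h (?n + k)"] deg
          by (simp add: coeff_1)
        have "coeff (g * t) (?n + k) =
            (\<Sum>i\<in>{..?n + k} - {?n}. coeff g i * coeff t (?n + k - i)) + ?b * coeff t k"
          by (simp add: coeff_mult sum.remove[of _ ?n])
        moreover have "c dvd ?b ^ (d - k) * (coeff g i * coeff t (?n + k - i))"
          if "i \<in> {..?n + k} - {?n}" for i
        proof (cases "i < ?n")
          case True
          have "c dvd ?b ^ (Suc d - (?n + k - i)) * coeff t (?n + k - i)"
            by (rule less) (use True \<open>k \<le> d\<close> in auto)
          moreover have "?b ^ (Suc d - (?n + k - i)) dvd ?b ^ (d - k)"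
            by (rule le_imp_power_dvd) (use True in auto)
          ultimately have "c dvd ?b ^ (d - k) * coeff t (?n + k - i)"
            by (meson dvd_trans dvd_refl mult_dvd_mono)
          then show ?thesis
            by (metis dvd_mult mult.left_commute)
        next
          case False
          then have "coeff g i = 0"
            using that by (simp add: coeff_eq_0)
          then show ?thesis
            by simp
        qed
        then have "c dvd ?b ^ (d - k) *
            (\<Sum>i\<in>{..?n + k} - {?n}. coeff g i * coeff t (?n + k - i))" (is "_ dvd _ * ?S")
          unfolding sum_distrib_left by (rule dvd_sum)
        ultimately have "c dvd ?b * ?b ^ (d - k) * coeff t k"
          using coeffs by (intro dvd_last_summand[of c "coeff s (?n + k)" ?S]) simp_all
        then show ?thesis
          using True by (simp add: Suc_diff_le)
      qed
    qed
    moreover have "?b ^ (Suc d - k) dvd ?b ^ Suc d"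
      by (rule le_imp_power_dvd) simp
    ultimately show ?thesis
      by (meson dvd_trans dvd_refl mult_dvd_mono)
  qed
  have "c * coeff s 0 + coeff g 0 * coeff t 0 = 1"
    using arg_cong[OF st, of "\<lambda>h. coeff h 0"] by (simp add: coeff_mult)
  then have "?b ^ Suc d = ?b ^ Suc d * (c * coeff s 0 + coeff g 0 * coeff t 0)"
    by (simp only: mult_1_right)
  also have "\<dots> = c * (?b ^ Suc d * coeff s 0) + coeff g 0 * (?b ^ Suc d * coeff t 0)"
    by (simp only: distrib_left mult.left_commute)
  finally have "?b ^ Suc d = \<dots>" .
  then have "c dvd ?b ^ Suc d"
    using *[of 0] by (metis dvd_add dvd_mult dvd_triv_left)
  then show ?thesis ..
qed

text \<open>
  Divide \<open>c\<close> by \<open>b\<close> for as long as the quotient is a multiple of \<open>b\<close>. Cancellation is not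
  available when \<open>b\<close> is a zero divisor, and then the process may reach \<open>b ^ N\<close> without leaving a
  divisor of \<open>b\<close>. In that case \<open>c\<close> and \<open>b * c\<close> divide each other with \<open>b\<close> a nonunit, and locality
  forces \<open>c = 0\<close>.
\<close>

lemma valuation_ring_split_off_power:
  fixes b c :: "'v::comm_ring_1"
  assumes V: "valuation_ring TYPE('v)" and "c dvd b ^ N"
  shows "c = 0 \<or> (\<exists>k c'. c = b ^ k * c' \<and> c' dvd b)"
  using assms(2)
proof (induction N arbitrary: c)
  case 0
  then have "c dvd b"
    by (metis dvd_trans one_dvd power_0)
  then show ?case
    by (intro disjI2 exI[of _ 0] exI[of _ c]) simp
next
  case (Suc N)
  show ?case
  proof (cases "c dvd b")
    case True
    then show ?thesis
      by (intro disjI2 exI[of _ 0] exI[of _ c]) simp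
  next
    case False
    then obtain c1 where c1: "c = b * c1"
      using V unfolding valuation_ring_def by (meson dvdE)
    show ?thesis
    proof (cases "c1 dvd b ^ N")
      case True
      from Suc.IH[OF this] show ?thesis
      proof
        assume "\<exists>k c'. c1 = b ^ k * c' \<and> c' dvd b"
        then obtain k c' where "c1 = b ^ k * c'" "c' dvd b"
          by blast
        then show ?thesis
          using c1 by (intro disjI2 exI[of _ "Suc k"] exI[of _ c']) (simp add: mult.assoc)
      qed (simp add: c1)
    next
      case False
      then obtain s where s: "c1 = b ^ N * s"
        using V unfolding valuation_ring_def by (meson dvdE)
      then have c: "c = b ^ Suc N * s"
        using c1 by (simp add: mult.assoc)
      show ?thesis
      proof (cases "s dvd b")
        case True
        then show ?thesis
          using c by blast
      next
        case False
        then obtain z where z: "s = b * z"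
          using V unfolding valuation_ring_def by (meson dvdE)
        obtain t where t: "b ^ Suc N = c * t"
          using Suc.prems by (auto elim: dvdE)
        have "c * (1 - t * b * z) = 0"
        proof -
          have "c * (1 - t * b * z) = c - (c * t) * b * z"
            by (simp add: algebra_simps)
          also have "\<dots> = c - b ^ Suc N * s"
            by (simp only: t z mult.assoc)
          finally show ?thesis
            using c by simp
        qed
        \<comment> \<open>So \<open>c\<close> vanishes once \<open>b\<close> is known to be a nonunit: then \<open>1 - t * b * z\<close> is a unit.\<close>
        have "\<not> t * b * z dvd 1"
        proof
          assume "t * b * z dvd 1"
          then have "b dvd 1"
            by (meson dvd_mult_left dvd_mult_right)
          then have "b ^ Suc N dvd 1"
            using dvd_power_same[of b 1 "Suc N"] by simp
          then have "c dvd b"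
            using Suc.prems by (meson dvd_trans one_dvd)
          with \<open>\<not> c dvd b\<close> show False ..
        qed
        then have "1 - t * b * z dvd 1"
          using valuation_ring_unit_add[OF V, of "1 - t * b * z" "t * b * z"]
          unfolding diff_add_cancel by (blast intro: dvd_refl)
        then obtain w where w: "1 = (1 - t * b * z) * w"
          by (rule dvdE)
        have "c = c * ((1 - t * b * z) * w)"
          by (simp only: mult_1_right flip: w)
        also have "\<dots> = (c * (1 - t * b * z)) * w"
          by (simp only: mult.assoc)
        finally have "c = 0"
          using \<open>c * (1 - t * b * z) = 0\<close> by simp
        then show ?thesis ..
      qed
    qed
  qed
qed

lemma const_poly_unit:
  assumes "c dvd 1"
  shows "[:c::'a::comm_ring_1:] dvd 1"
proof -
  obtain v where "1 = c * v"
    using assms by (rule dvdE)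
  then have "1 = [:c:] * [:v:]"
    by (simp add: one_pCons mult.commute)
  then show ?thesis
    by (rule dvdI)
qed

text \<open>
  The induction is on the degree of \<open>g\<close>. A constant that divides the leading coefficient allows
  the leading term of \<open>g\<close> to be removed, and \<open>c\<close> is a product of such constants unless it is 0,
  in which case \<open>g\<close> is a unit.
\<close>

lemma mennicke_trivial_const:
  fixes c :: "'v::comm_ring_1"
  assumes V: "valuation_ring TYPE('v)" and "comaximal [:c:] g"
  shows "mennicke_trivial [:c:] g"
  using assms(2)
proof (induction "degree g" arbitrary: c g rule: less_induct)
  case less
  show ?case
  proof (cases "degree g = 0")
    case True
    then obtain e where g: "g = [:e:]"
      by (meson degree_eq_zeroE)
    then have "c dvd 1 \<or> e dvd 1"
      using valuation_ring_comaximal_unit[OF V] comaximal_coeff_0[OF less.prems] by simp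
    then show ?thesis
      unfolding g
      by (auto intro: mennicke_trivial_unit_left mennicke_trivial_unit_right
          simp: const_poly_unit)
  next
    case False
    let ?b = "lead_coeff g" and ?n = "degree g"
    have strip: "mennicke_trivial [:e:] g" if e: "e dvd ?b" and "comaximal [:e:] g" for e
    proof -
      obtain r where r: "?b = e * r"
        using e by (rule dvdE)
      let ?g' = "g - monom r ?n * [:e:]"
      have "degree ?g' < degree g"
      proof -
        have "degree ?g' \<le> degree g"
          by (intro degree_diff_le) (auto simp: smult_monom intro: degree_monom_le)
        moreover have "coeff ?g' ?n = 0"
          using r by (simp add: mult.commute)
        ultimately show ?thesis
          using False by (metis degree_0 le_neq_implies_less leading_coeff_0_iff neq0_conv)
      qed
      moreover have "comaximal [:e:] ?g'"
        using \<open>comaximal [:e:] g\<close> by (rule comaximal_commute[OF comaximal_diff_left[OF comaximal_commute]])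
      ultimately have "mennicke_trivial [:e:] ?g'"
        by (rule less.hyps)
      from mennicke_trivial_add_right[OF this, of "monom r ?n"] show ?thesis
        by simp
    qed
    obtain N where "c dvd ?b ^ N"
      using lead_coeff_nilpotent_mod[OF less.prems] False by auto
    then consider "c = 0" | k c' where "c = ?b ^ k * c'" "c' dvd ?b"
      using valuation_ring_split_off_power[OF V, of c ?b N] by blast
    then show ?thesis
    proof cases
      case 1
      then obtain t where "t * g = 1"
        using less.prems by (auto simp: comaximal_def)
      then have "g dvd 1"
        by (metis dvd_triv_right)
      then show ?thesis
        by (rule mennicke_trivial_unit_right)
    next
      case (2 k c')
      have eq: "[:c:] = [:?b:] ^ k * [:c':]"
        by (simp add: 2 poly_const_pow)
      have "mennicke_trivial [:c':] g"
        by (intro strip 2 comaximal_dvd_left[OF less.prems]) (simp only: eq dvd_triv_right)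
      \<comment> \<open>For \<open>k = 0\<close> the leading coefficient itself need not be comaximal with \<open>g\<close>.\<close>
      moreover have "mennicke_trivial ([:?b:] ^ k) g"
      proof (cases k)
        case (Suc l)
        then have "[:?b:] dvd [:c:]"
          by (simp only: eq power_Suc mult.assoc dvd_triv_left)
        then show ?thesis
          by (intro mennicke_trivial_power strip) (auto intro: comaximal_dvd_left[OF less.prems])
      qed (simp add: mennicke_trivial_one)
      ultimately show ?thesis
        unfolding eq by (rule mennicke_trivial_mult[rotated])
    qed
  qed
qed

section \<open>Reduction of degrees\<close>

text \<open>
  The degree of \<open>f\<close> drops below the common bound because \<open>a\<close> is a constant: subtracting \<open>a g\<close>
  respects the bound, and the division by \<open>x\<close> then lowers it. The factor \<open>x\<close> is harmless since
  \<open>g\<close> is congruent to a unit modulo \<open>x\<close>. That \<open>a\<close> is a multiple of the constant term of \<open>f\<close>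
  keeps \<open>a\<close> in the maximal ideal when that term is not a unit.
\<close>

lemma cancel_constant_term:
  fixes f g :: "'v::comm_ring_1 poly"
  assumes "coeff g 0 dvd 1" and "comaximal f g" and "degree f \<le> Suc n" and "degree g \<le> Suc n"
  obtains a h where "coeff f 0 dvd a" and "f = pCons 0 h + [:a:] * g" and "comaximal h g"
    and "degree h \<le> n"
    and "mennicke_trivial h g \<longrightarrow> mennicke_trivial f g"
proof -
  obtain v where v: "coeff g 0 * v = 1"
    using assms(1) by (metis dvdE)
  let ?a = "coeff f 0 * v"
  obtain r h where rh: "f - [:?a:] * g = pCons r h"
    by (rule pCons_cases)
  have "r = coeff f 0 - ?a * coeff g 0"
    using arg_cong[OF rh, of "\<lambda>p. coeff p 0"] by simp
  then have "r = 0"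
    using v by (simp add: mult.assoc mult.commute[of v])
  then have eq: "f - [:?a:] * g = pCons 0 h"
    using rh by simp
  then have f: "f = pCons 0 h + [:?a:] * g"
    by (metis diff_add_cancel)
  have xh: "pCons 0 h = [:0, 1:] * h"
    by simp
  have "mennicke_trivial [:0, 1:] g"
  proof -
    obtain e g' where "g = pCons e g'"
      by (rule pCons_cases)
    then have g: "g = [:e:] + g' * [:0, 1:]" and "e dvd 1"
      using assms(1) by auto
    then show ?thesis
      unfolding g by (intro mennicke_trivial_add_right mennicke_trivial_unit_right const_poly_unit)
  qed
  then have triv: "mennicke_trivial f g" if "mennicke_trivial h g"
    by (subst f, subst xh) (intro mennicke_trivial_add_left mennicke_trivial_mult that)
  have "comaximal (pCons 0 h) g"
    using comaximal_diff_left[OF assms(2), of "[:?a:]"] eq by simp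
  then have "comaximal h g"
    by (rule comaximal_dvd_left) (simp only: xh dvd_triv_right)
  moreover have "degree h \<le> n"
  proof -
    have "degree (f - [:?a:] * g) \<le> Suc n"
      using assms(3,4) by (intro degree_diff_le) (auto intro: order.trans[OF degree_smult_le])
    then show ?thesis
      unfolding eq by (auto simp: degree_pCons_eq_if split: if_splits)
  qed
  ultimately show thesis
    using that[of ?a h] f triv by simp
qed

text \<open>
  The index \<open>k\<close> is the order of vanishing at 0 of \<open>f\<close> modulo the maximal ideal. While it is
  positive, \<open>f(0)\<close> lies in the maximal ideal, so \<open>f\<close> is congruent to \<open>x h\<close> there and \<open>h\<close> has order
  \<open>k - 1\<close>. At order 0 the roles are exchanged: \<open>f(0)\<close> is a unit, and \<open>f\<close> reduces the degree of
  \<open>g\<close> to at most \<open>n\<close>, where the induction hypothesis on degrees applies.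
\<close>

lemma mennicke_trivial_primitive:
  fixes f g :: "'v::comm_ring_1 poly"
  assumes V: "valuation_ring TYPE('v)"
    and IH: "\<And>f g :: 'v poly. degree f \<le> n \<Longrightarrow> degree g \<le> n \<Longrightarrow> comaximal f g \<Longrightarrow> mennicke_trivial f g"
    and g: "degree g \<le> Suc n" "coeff g 0 dvd 1"
    and "degree f \<le> n" "comaximal f g" "coeff f k dvd 1" "\<And>i. i < k \<Longrightarrow> \<not> coeff f i dvd 1"
  shows "mennicke_trivial f g"
  using assms(5-)
proof (induction k arbitrary: f)
  case 0
  obtain a h where "coeff g 0 dvd a" "g = pCons 0 h + [:a:] * f" and "comaximal h f" "degree h \<le> n"
    and "mennicke_trivial h f \<longrightarrow> mennicke_trivial g f"
    by (rule cancel_constant_term[OF 0(3) comaximal_commute[OF 0(2)] g(1) le_SucI[OF 0(1)]])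
  then show ?case
    using IH 0(1) mennicke_trivial_commute by blast
next
  case (Suc k)
  obtain a h where a: "coeff f 0 dvd a" and f: "f = pCons 0 h + [:a:] * g" and "comaximal h g"
    and "degree h \<le> n" and triv: "mennicke_trivial h g \<longrightarrow> mennicke_trivial f g"
    by (rule cancel_constant_term[OF g(2) Suc.prems(2) le_SucI[OF Suc.prems(1)] g(1)])
  have "\<not> a dvd 1"
    using a Suc.prems(4)[of 0] dvd_trans by blast
  then have a': "\<not> a * r dvd 1" for r
    using dvd_mult_left by blast
  have coeff: "coeff f (Suc i) = coeff h i + a * coeff g (Suc i)" for i
    by (simp add: f)
  have "coeff h k dvd 1"
    using Suc.prems(3) a' valuation_ring_unit_add[OF V] unfolding coeff by blast
  moreover have "\<not> coeff h i dvd 1" if "i < k" for i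
  proof
    assume "coeff h i dvd 1"
    then have "coeff f (Suc i) + a * - coeff g (Suc i) dvd 1"
      by (simp add: coeff)
    then show False
      using a' Suc.prems(4)[of "Suc i"] that valuation_ring_unit_add[OF V] by blast
  qed
  ultimately show ?case
    using Suc.IH[of h] \<open>comaximal h g\<close> \<open>degree h \<le> n\<close> triv by blast
qed

text \<open>
  After the reduction of \<open>f\<close> to its primitive part only the bound on \<open>f\<close> has dropped to \<open>n\<close>; the
  preceding lemma deals with such unbalanced pairs.
\<close>

lemma mennicke_trivial_valuation_ring_poly:
  fixes f g :: "'v::comm_ring_1 poly"
  assumes V: "valuation_ring TYPE('v)"
    and "degree f \<le> n" "degree g \<le> n" "comaximal f g"
  shows "mennicke_trivial f g"
  using assms(2-)
proof (induction n arbitrary: f g)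
  case 0
  then obtain c where "f = [:c:]"
    by (metis degree_eq_zeroE le_zero_eq)
  then show ?case
    using mennicke_trivial_const[OF V] 0 by blast
next
  case (Suc n)
  have main: "mennicke_trivial f g"
    if deg: "degree f \<le> Suc n" "degree g \<le> Suc n" and fg: "comaximal f g" and g0: "coeff g 0 dvd 1"
    for f g :: "'v poly"
  proof -
    obtain a h where "coeff f 0 dvd a" "f = pCons 0 h + [:a:] * g" and h: "comaximal h g" "degree h \<le> n"
      and triv: "mennicke_trivial h g \<longrightarrow> mennicke_trivial f g"
      by (rule cancel_constant_term[OF g0 fg deg])
    obtain c h' where h': "h = smult c h'" "degree h' \<le> degree h" and "\<exists>k. coeff h' k dvd 1"
      using valuation_ring_primitive_part[OF V, of h] by blast
    then obtain k where k: "coeff h' k dvd 1" "\<And>i. i < k \<Longrightarrow> \<not> coeff h' i dvd 1"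
      using exists_least_iff[of "\<lambda>k. coeff h' k dvd 1"] by auto
    have eq: "h = [:c:] * h'"
      by (simp add: h')
    have "mennicke_trivial h' g"
    proof (rule mennicke_trivial_primitive[OF V Suc.IH deg(2) g0 _ _ k])
      show "degree h' \<le> n"
        using h(2) h'(2) by linarith
      show "comaximal h' g"
        by (rule comaximal_dvd_left[OF h(1)]) (simp only: eq dvd_triv_right)
    qed
    moreover have "mennicke_trivial [:c:] g"
      by (rule mennicke_trivial_const[OF V comaximal_dvd_left[OF h(1)]]) (simp only: eq dvd_triv_left)
    ultimately have "mennicke_trivial h g"
      unfolding eq by (rule mennicke_trivial_mult[rotated])
    then show ?thesis
      using triv by blast
  qed
  have "coeff f 0 dvd 1 \<or> coeff g 0 dvd 1"
    by (intro valuation_ring_comaximal_unit[OF V] comaximal_coeff_0 Suc.prems)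
  then show ?case
  proof
    assume "coeff f 0 dvd 1"
    then have "mennicke_trivial g f"
      by (intro main Suc.prems comaximal_commute[OF Suc.prems(3)])
    then show ?thesis
      by (rule mennicke_trivial_commute)
  next
    assume "coeff g 0 dvd 1"
    then show ?thesis
      by (intro main Suc.prems)
  qed
qed

theorem theorem4p1:
  fixes f g p q :: "'v::comm_ring_1 poly"
    and M :: "'v poly ^ 3 ^ 3"
  assumes "valuation_ring TYPE('v)"
    and "M = vector [vector [f, g, 0],
                     vector [p, q, 0],
                     vector [0, 0, 1]]"
    and "M \<in> carrier SL"
  shows "M \<in> elementary_subgroup"
proof -
  have M: "M = mat3 f g 0 p q 0 0 0 1"
    by (simp add: assms(2) mat3_def)
  have det: "f * q - g * p = 1"
    using assms(3) by (simp add: SL_def M det_mat3)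
  then have "q * f + (- p) * g = 1"
    by (simp add: mult.commute)
  then have "comaximal f g"
    unfolding comaximal_def by blast
  then have "mennicke_trivial f g"
    by (intro mennicke_trivial_valuation_ring_poly[OF assms(1), of _ "max (degree f) (degree g)"]) auto
  then show ?thesis
    unfolding M using det by (rule mennicke_trivial_any_completion)
qed

end
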